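(* The space $\mathscr S'$ of tempered distributions, identified with $\mathcal F_a'$ for $A=\{1\}$, $\ell_A=\mathbb N_0$ and $a_n=(n+1)^2$, is a regular admissible space which is nuclear, but is not a Våge space.
   Context: $\mathbb N=\{1,2,\dots\}$, $\mathbb N_0=\mathbb N\cup\{0\}$. $\mathscr S$ is the Schwartz space of smooth rapidly decreasing complex functions on $\mathbb R$; expanding in Hermite functions, it is identified with the Fréchet space of sequences $(f_n)_{n\in\mathbb N_0}$ with $\sum_n|f_n|^2(n+1)^{2p}<\infty$ for all $p\in\mathbb N$, and its strong dual $\mathscr S'$ with the sequences $(f_n)$ with $\sum_n|f_n|^2(n+1)^{-2p}<\infty$ for some $p\in\mathbb N$. For $A=\{1\}$, $\ell_A=\mathbb N_0$ (with $e_1=1$). A positive function $a:\mathbb N_0\to\mathbb R$, $n\mapsto a_n>0$, is admissible if $a_0=1$ and $a_1>1$; an admissible $a$ is $d$-regular ($d\in\mathbb N$) if $\sum_{n\in A}\frac{1}{a_{e_n}^d-1}<\infty$ (here a single term). $\mathcal F_a=\{(\varphi_n):\sum_n|\varphi_n|^2a_n^p<\infty\ \forall p\in\mathbb N\}$, and $\mathcal F_a'=\bigcup_{p\in\mathbb N}\ell^2_{a^{-p}}$ is its dual, where $\ell^2_{a^{-p}}=\{f=(f_n):\|f\|_p<\infty\}$, $\|f\|_p=(\sum_n|f_n|^2a_n^{-p})^{1/2}$; $\mathcal F_a'$ is called a regular admissible space if $a$ is admissible and $d$-regular for some $d\in\mathbb N$. Convolution: $f*g=(\sum_{m\le n}f_mg_{n-m})_{n\in\mathbb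 N_0}$. A regular admissible space $\mathcal F_a'$ is a Våge space if there is $e\in\mathbb N$ and finite positive numbers $A(k)$, $k\ge e$ (depending only on $k$), such that for all $q\in\mathbb N$ and all $p\ge q+e$, $\|f*g\|_p\le A(p-q)\|f\|_q\|g\|_p$ for all $f\in\ell^2_{a^{-q}}$ and $g\in\ell^2_{a^{-p}}$. *)

theory Defs
  imports "HOL-Analysis.Analysis" "HOL-Library.Function_Algebras"
begin

section \<open>Nuclear locally convex spaces\<close>

text \<open>
  A complex topological vector space is given by an ambient complex vector space
  (type \<open>'a\<close> with scalar multiplication \<open>smul\<close>), a subspace \<open>E\<close> and a topology \<open>T\<close>
  whose underlying set is \<open>E\<close>.
\<close>

definition locally_convex_space ::
  "(complex \<Rightarrow> 'a::ab_group_add \<Rightarrow> 'a) \<Rightarrow> 'a set \<Rightarrow> 'a topology \<Rightarrow> bool" where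
  "locally_convex_space smul E T \<longleftrightarrow>
     vector_space smul \<and> module.subspace smul E \<and>
     topspace T = E \<and> Hausdorff_space T \<and>
     continuous_map (prod_topology T T) T (\<lambda>(x, y). x + y) \<and>
     continuous_map (prod_topology euclidean T) T (\<lambda>(c, x). smul c x) \<and>
     (\<forall>U. openin T U \<and> 0 \<in> U \<longrightarrow>
        (\<exists>V. openin T V \<and> 0 \<in> V \<and> V \<subseteq> U \<and>
           (\<forall>x\<in>V. \<forall>y\<in>V. \<forall>t\<in>{0..1::real}.
              smul (of_real (1 - t)) x + smul (of_real t) y \<in> V)))"

definition continuous_seminorm ::
  "(complex \<Rightarrow> 'a::ab_group_add \<Rightarrow> 'a) \<Rightarrow> 'a set \<Rightarrow> 'a topology \<Rightarrow> ('a \<Rightarrow> real) \<Rightarrow> bool" where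
  "continuous_seminorm smul E T p \<longleftrightarrow>
     (\<forall>x\<in>E. 0 \<le> p x) \<and>
     (\<forall>x\<in>E. \<forall>y\<in>E. p (x + y) \<le> p x + p y) \<and>
     (\<forall>c. \<forall>x\<in>E. p (smul c x) = cmod c * p x) \<and>
     continuous_map T euclideanreal p"

definition linear_functional_on ::
  "(complex \<Rightarrow> 'a::ab_group_add \<Rightarrow> 'a) \<Rightarrow> 'a set \<Rightarrow> ('a \<Rightarrow> complex) \<Rightarrow> bool" where
  "linear_functional_on smul E l \<longleftrightarrow>
     (\<forall>x\<in>E. \<forall>y\<in>E. l (x + y) = l x + l y) \<and>
     (\<forall>c. \<forall>x\<in>E. l (smul c x) = c * l x)"

text \<open>
  For seminorms \<open>p \<le> q\<close> on \<open>E\<close>, this says that the canonical map from \<open>E\<close> modulo the null space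
  of \<open>q\<close> to \<open>E\<close> modulo the null space of \<open>p\<close> is a nuclear map of normed spaces: it equals
  \<open>x \<mapsto> \<Sum>i. l i x \<cdot> y i\<close> with \<open>(\<Sum>i. \<parallel>l i\<parallel> \<parallel>y i\<parallel>) < \<infinity>\<close>, where \<open>c i\<close> bounds the dual norm of
  \<open>l i\<close>.  Everything is expressed on representatives in \<open>E\<close>.  Taking the \<open>y i\<close> in the quotient or
  in its completion gives the same notion, since every element of the completion is an absolutely
  convergent series of elements of the quotient.
\<close>

definition nuclear_canonical_map ::
  "(complex \<Rightarrow> 'a::ab_group_add \<Rightarrow> 'a) \<Rightarrow> 'a set \<Rightarrow> ('a \<Rightarrow> real) \<Rightarrow> ('a \<Rightarrow> real) \<Rightarrow> bool" where
  "nuclear_canonical_map smul E q p \<longleftrightarrow>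
     (\<exists>(l :: nat \<Rightarrow> 'a \<Rightarrow> complex) (y :: nat \<Rightarrow> 'a) (c :: nat \<Rightarrow> real).
        (\<forall>i. linear_functional_on smul E (l i)) \<and>
        (\<forall>i. 0 \<le> c i \<and> (\<forall>x\<in>E. cmod (l i x) \<le> c i * q x)) \<and>
        (\<forall>i. y i \<in> E) \<and>
        summable (\<lambda>i. c i * p (y i)) \<and>
        (\<forall>x\<in>E. (\<lambda>n. p (x - (\<Sum>i<n. smul (l i x) (y i)))) \<longlonglongrightarrow> 0))"

definition nuclear_space ::
  "(complex \<Rightarrow> 'a::ab_group_add \<Rightarrow> 'a) \<Rightarrow> 'a set \<Rightarrow> 'a topology \<Rightarrow> bool" where
  "nuclear_space smul E T \<longleftrightarrow>
     locally_convex_space smul E T \<and>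
     (\<forall>p. continuous_seminorm smul E T p \<longrightarrow>
        (\<exists>q. continuous_seminorm smul E T q \<and> (\<forall>x\<in>E. p x \<le> q x) \<and>
             nuclear_canonical_map smul E q p))"

section \<open>Sequence spaces\<close>

type_synonym seq = "nat \<Rightarrow> complex"

definition seq_scale :: "complex \<Rightarrow> seq \<Rightarrow> seq" where
  "seq_scale c f = (\<lambda>n. c * f n)"

definition weighted_l2 :: "(nat \<Rightarrow> real) \<Rightarrow> seq set" where
  "weighted_l2 w = {f. summable (\<lambda>n. (cmod (f n))\<^sup>2 * w n)}"

definition weighted_norm :: "(nat \<Rightarrow> real) \<Rightarrow> seq \<Rightarrow> real" where
  "weighted_norm w f = sqrt (\<Sum>n. (cmod (f n))\<^sup>2 * w n)"

definition pairing :: "seq \<Rightarrow> seq \<Rightarrow> complex" where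
  "pairing f \<phi> = (\<Sum>n. f n * \<phi> n)"

text \<open>
  The strong dual topology on a space \<open>D'\<close> of sequences which is identified, through \<open>pairing\<close>,
  with the dual of the space \<open>D\<close> topologised by the norms \<open>N 1, N 2, \<dots>\<close>: uniform convergence on
  the bounded subsets of \<open>D\<close>.
\<close>

definition bounded_subset :: "(nat \<Rightarrow> seq \<Rightarrow> real) \<Rightarrow> seq set \<Rightarrow> seq set \<Rightarrow> bool" where
  "bounded_subset N D B \<longleftrightarrow> B \<subseteq> D \<and> (\<forall>p\<ge>1. bdd_above (N p ` B))"

definition strong_open :: "(nat \<Rightarrow> seq \<Rightarrow> real) \<Rightarrow> seq set \<Rightarrow> seq set \<Rightarrow> seq set \<Rightarrow> bool" where
  "strong_open N D D' U \<longleftrightarrow>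
     U \<subseteq> D' \<and>
     (\<forall>f\<in>U. \<exists>B \<epsilon>. bounded_subset N D B \<and> 0 < \<epsilon> \<and>
        {g \<in> D'. \<forall>\<phi>\<in>B. cmod (pairing (g - f) \<phi>) < \<epsilon>} \<subseteq> U)"

definition strong_dual_topology ::
  "(nat \<Rightarrow> seq \<Rightarrow> real) \<Rightarrow> seq set \<Rightarrow> seq set \<Rightarrow> seq topology" where
  "strong_dual_topology N D D' = topology (strong_open N D D')"

lemma istopology_strong_open: "istopology (strong_open N D D')"
  unfolding istopology_def
proof (intro conjI allI impI)
  fix S T assume S: "strong_open N D D' S" and T: "strong_open N D D' T"
  show "strong_open N D D' (S \<inter> T)"
    unfolding strong_open_def
  proof (intro conjI ballI)
    show "S \<inter> T \<subseteq> D'" using S by (auto simp: strong_open_def)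
    fix f assume f: "f \<in> S \<inter> T"
    obtain B1 e1 where 1: "bounded_subset N D B1" "0 < e1"
      "{g \<in> D'. \<forall>\<phi>\<in>B1. cmod (pairing (g - f) \<phi>) < e1} \<subseteq> S"
      using S f unfolding strong_open_def by blast
    obtain B2 e2 where 2: "bounded_subset N D B2" "0 < e2"
      "{g \<in> D'. \<forall>\<phi>\<in>B2. cmod (pairing (g - f) \<phi>) < e2} \<subseteq> T"
      using T f unfolding strong_open_def by blast
    have "bounded_subset N D (B1 \<union> B2)"
      using 1(1) 2(1) by (auto simp: bounded_subset_def image_Un)
    moreover have "{g \<in> D'. \<forall>\<phi>\<in>B1 \<union> B2. cmod (pairing (g - f) \<phi>) < min e1 e2} \<subseteq> S \<inter> T"
      using 1(3) 2(3) by auto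
    ultimately show "\<exists>B \<epsilon>. bounded_subset N D B \<and> 0 < \<epsilon> \<and>
        {g \<in> D'. \<forall>\<phi>\<in>B. cmod (pairing (g - f) \<phi>) < \<epsilon>} \<subseteq> S \<inter> T"
      using 1(2) 2(2) by (intro exI[of _ "B1 \<union> B2"] exI[of _ "min e1 e2"]) simp
  qed
next
  fix \<K> assume K: "\<forall>K\<in>\<K>. strong_open N D D' K"
  show "strong_open N D D' (\<Union>\<K>)"
    unfolding strong_open_def
  proof (intro conjI ballI)
    show "\<Union>\<K> \<subseteq> D'" using K by (auto simp: strong_open_def)
    fix f assume "f \<in> \<Union>\<K>"
    then obtain K where K': "K \<in> \<K>" "f \<in> K" by blast
    then obtain B e where "bounded_subset N D B" "0 < e"
      "{g \<in> D'. \<forall>\<phi>\<in>B. cmod (pairing (g - f) \<phi>) < e} \<subseteq> K"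
      using K unfolding strong_open_def by blast
    then show "\<exists>B \<epsilon>. bounded_subset N D B \<and> 0 < \<epsilon> \<and>
        {g \<in> D'. \<forall>\<phi>\<in>B. cmod (pairing (g - f) \<phi>) < \<epsilon>} \<subseteq> \<Union>\<K>"
      using K' by blast
  qed
qed

lemma openin_strong_dual_topology:
  "openin (strong_dual_topology N D D') = strong_open N D D'"
  unfolding strong_dual_topology_def by (rule topology_inverse'[OF istopology_strong_open])

section \<open>Tempered distributions\<close>

text \<open>
  The Schwartz space and its strong dual, both described by Hermite coefficients.
\<close>

definition schwartz_norm :: "nat \<Rightarrow> seq \<Rightarrow> real" where
  "schwartz_norm p = weighted_norm (\<lambda>n. (real n + 1) ^ (2 * p))"

definition schwartz_space :: "seq set" where
  "schwartz_space = (\<Inter>p\<in>{1..}. weighted_l2 (\<lambda>n. (real n + 1) ^ (2 * p)))"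

definition tempered_distributions :: "seq set" where
  "tempered_distributions = (\<Union>p\<in>{1..}. weighted_l2 (\<lambda>n. inverse ((real n + 1) ^ (2 * p))))"

definition tempered_topology :: "seq topology" where
  "tempered_topology =
     strong_dual_topology schwartz_norm schwartz_space tempered_distributions"

section \<open>Admissible spaces and Vage spaces\<close>

text \<open>
  Only the index set \<open>A = {1}\<close> is considered, so that multi-indices are natural numbers and the
  unit multi-index belonging to \<open>j \<in> A\<close> is \<open>j = 1\<close> itself.
\<close>

definition admissible :: "(nat \<Rightarrow> real) \<Rightarrow> bool" where
  "admissible a \<longleftrightarrow> (\<forall>n. 0 < a n) \<and> a 0 = 1 \<and> a 1 > 1"

definition regular :: "nat \<Rightarrow> (nat \<Rightarrow> real) \<Rightarrow> bool" where
  "regular d a \<longleftrightarrow> admissible a \<and> (\<lambda>j. 1 / (a j ^ d - 1)) summable_on {1::nat}"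

definition F_norm :: "(nat \<Rightarrow> real) \<Rightarrow> nat \<Rightarrow> seq \<Rightarrow> real" where
  "F_norm a p = weighted_norm (\<lambda>n. a n ^ p)"

definition F_space :: "(nat \<Rightarrow> real) \<Rightarrow> seq set" where
  "F_space a = (\<Inter>p\<in>{1..}. weighted_l2 (\<lambda>n. a n ^ p))"

definition dual_l2 :: "(nat \<Rightarrow> real) \<Rightarrow> nat \<Rightarrow> seq set" where
  "dual_l2 a p = weighted_l2 (\<lambda>n. inverse (a n ^ p))"

definition dual_norm :: "(nat \<Rightarrow> real) \<Rightarrow> nat \<Rightarrow> seq \<Rightarrow> real" where
  "dual_norm a p = weighted_norm (\<lambda>n. inverse (a n ^ p))"

definition F_dual :: "(nat \<Rightarrow> real) \<Rightarrow> seq set" where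
  "F_dual a = (\<Union>p\<in>{1..}. dual_l2 a p)"

definition F_dual_topology :: "(nat \<Rightarrow> real) \<Rightarrow> seq topology" where
  "F_dual_topology a = strong_dual_topology (F_norm a) (F_space a) (F_dual a)"

text \<open>
  The next two predicates are properties of the space \<open>F_dual a\<close>, presented by its weight \<open>a\<close>.
\<close>

definition regular_admissible_space :: "(nat \<Rightarrow> real) \<Rightarrow> bool" where
  "regular_admissible_space a \<longleftrightarrow> admissible a \<and> (\<exists>d\<ge>1. regular d a)"

definition convolution :: "seq \<Rightarrow> seq \<Rightarrow> seq" where
  "convolution f g = (\<lambda>n. \<Sum>m\<le>n. f m * g (n - m))"

text \<open>
  Norms are real-valued here, so finiteness of the left-hand norm in the Vage inequality is
  stated as membership of the convolution in the \<open>p\<close>-th space.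
\<close>

definition vage_space :: "(nat \<Rightarrow> real) \<Rightarrow> bool" where
  "vage_space a \<longleftrightarrow>
     regular_admissible_space a \<and>
     (\<exists>e\<ge>1. \<exists>A :: nat \<Rightarrow> real.
        (\<forall>k\<ge>e. 0 < A k) \<and>
        (\<forall>q\<ge>1. \<forall>p\<ge>q + e. \<forall>f\<in>dual_l2 a q. \<forall>g\<in>dual_l2 a p.
           convolution f g \<in> dual_l2 a p \<and>
           dual_norm a p (convolution f g) \<le> A (p - q) * dual_norm a q f * dual_norm a p g))"

end

theory Submission
  imports Defs
begin

text \<open>
  The strong topology is generated by the weighted \<open>l1\<close> norms \<open>f \<mapsto> \<Sum>n. \<bar>f n\<bar> \<cdot> b n\<close> with \<open>b\<close>
  rapidly decreasing: a bounded set of test sequences is dominated by such a \<open>b\<close>, and conversely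
  the norm is the supremum of the pairings with the bounded box \<open>\<bar>\<phi> n\<bar> \<le> b n\<close>.  A continuous
  seminorm \<open>p\<close> is thus bounded by the norm of some \<open>b\<close>; against the norm of \<open>(n + 1)\<^sup>2 \<cdot> b n\<close> the
  expansion in unit sequences is nuclear, because \<open>\<Sum>n. 1 / (n + 1)\<^sup>2\<close> converges.

  The Vage inequality already fails for \<open>q = 1\<close> and \<open>p = e + 1\<close>: for \<open>f n = 1\<close> and
  \<open>g n = (n + 1) ^ e\<close> the convolution grows like \<open>(n + 1) ^ (e + 1)\<close>, too fast for the \<open>p\<close>-th space.
\<close>

section \<open>Rapidly decreasing weights and the \<open>l1\<close> norms they define on tempered
  sequences\<close>

definition rapidly_decreasing :: "(nat \<Rightarrow> real) \<Rightarrow> bool" where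
  "rapidly_decreasing b \<longleftrightarrow> (\<forall>n. 0 \<le> b n) \<and> (\<forall>k. \<exists>K. \<forall>n. b n * (real n + 1) ^ k \<le> K)"

text \<open>A divergent \<open>suminf\<close> carries no information, so most facts about this norm
  assume a tempered sequence and a rapidly decreasing weight, which together force
  convergence.\<close>

definition l1_norm :: "(nat \<Rightarrow> real) \<Rightarrow> seq \<Rightarrow> real" where
  "l1_norm b f = (\<Sum>n. cmod (f n) * b n)"

text \<open>The comparison series behind the summability claims below: a supremum bound with a spare
  factor 1/(n + 1)^2 becomes a convergent sum.\<close>

lemma summable_inverse_Suc_square: "summable (\<lambda>n. inverse ((real n + 1)\<^sup>2))"
  using inverse_power_summable[of 2, where 'a=real] summable_Suc_iff[of "\<lambda>n. inverse ((real n)\<^sup>2)"]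
  by (simp add: add.commute)

lemma term_le_suminf:
  fixes h :: "nat \<Rightarrow> real"
  assumes "summable h" "\<And>n. 0 \<le> h n"
  shows "h n \<le> suminf h"
  using sum_le_suminf[of h "{n}"] assms by simp

lemma rapidly_decreasing_scale:
  assumes "rapidly_decreasing b" "0 \<le> c"
  shows "rapidly_decreasing (\<lambda>n. c * b n)"
  unfolding rapidly_decreasing_def
proof (intro conjI allI)
  fix k
  obtain K where "\<forall>n. b n * (real n + 1) ^ k \<le> K"
    using assms(1) unfolding rapidly_decreasing_def by blast
  then have "\<forall>n. c * b n * (real n + 1) ^ k \<le> c * K"
    using assms(2) by (simp add: mult.assoc mult_left_mono)
  then show "\<exists>K. \<forall>n. c * b n * (real n + 1) ^ k \<le> K" by blast
qed (use assms in \<open>auto simp: rapidly_decreasing_def\<close>)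

lemma rapidly_decreasing_times_power:
  assumes "rapidly_decreasing b"
  shows "rapidly_decreasing (\<lambda>n. (real n + 1) ^ j * b n)"
  unfolding rapidly_decreasing_def
proof (intro conjI allI)
  fix k
  show "\<exists>K. \<forall>n. (real n + 1) ^ j * b n * (real n + 1) ^ k \<le> K"
    using assms[unfolded rapidly_decreasing_def, THEN conjunct2, rule_format, of "j + k"]
    by (simp add: power_add mult_ac)
qed (use assms in \<open>auto simp: rapidly_decreasing_def\<close>)

text \<open>With \<open>c = 1\<close> the \<open>l1\<close> norm reads off the modulus of one
  coordinate, which separates points; with \<open>c = 0\<close> it is the zero weight, a witness for
  openness of the whole space.\<close>

lemma rapidly_decreasing_indicator: "rapidly_decreasing (\<lambda>i. if i = m then c else 0)" if "0 \<le> c"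
  unfolding rapidly_decreasing_def
proof (intro conjI allI)
  fix k
  have "\<forall>n. (if n = m then c else 0) * (real n + 1) ^ k \<le> c * (real m + 1) ^ k"
    using that by auto
  then show "\<exists>K. \<forall>n. (if n = m then c else 0) * (real n + 1) ^ k \<le> K" by blast
qed (use that in auto)

text \<open>A single term of the convergent series is at most its sum, which gives growth of order
  \<open>p\<close>. Conversely, for growth of order \<open>k\<close> the weight with
  \<open>p = Suc k\<close> leaves the summable factor 1/(n + 1)^2.\<close>

lemma tempered_distributions_iff:
  "f \<in> tempered_distributions \<longleftrightarrow> (\<exists>k K. \<forall>n. cmod (f n) \<le> K * (real n + 1) ^ k)"
proof
  assume "f \<in> tempered_distributions"
  then obtain p where s: "summable (\<lambda>n. (cmod (f n))\<^sup>2 * inverse ((real n + 1) ^ (2 * p)))"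
    by (auto simp: tempered_distributions_def weighted_l2_def)
  define S where "S = (\<Sum>n. (cmod (f n))\<^sup>2 * inverse ((real n + 1) ^ (2 * p)))"
  have "cmod (f n) \<le> sqrt S * (real n + 1) ^ p" for n
  proof -
    have "(cmod (f n))\<^sup>2 * inverse ((real n + 1) ^ (2 * p)) \<le> S"
      unfolding S_def by (rule term_le_suminf[OF s]) simp
    then have "(cmod (f n))\<^sup>2 \<le> S * ((real n + 1) ^ p)\<^sup>2"
      by (simp add: field_simps power_mult[symmetric])
    then have "sqrt ((cmod (f n))\<^sup>2) \<le> sqrt (S * ((real n + 1) ^ p)\<^sup>2)"
      by (rule real_sqrt_le_mono)
    then show ?thesis by (simp add: real_sqrt_mult)
  qed
  then show "\<exists>k K. \<forall>n. cmod (f n) \<le> K * (real n + 1) ^ k" by blast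
next
  assume "\<exists>k K. \<forall>n. cmod (f n) \<le> K * (real n + 1) ^ k"
  then obtain k K where K: "\<And>n. cmod (f n) \<le> K * (real n + 1) ^ k" by blast
  have "summable (\<lambda>n. (cmod (f n))\<^sup>2 * inverse ((real n + 1) ^ (2 * Suc k)))"
  proof (rule summable_comparison_test')
    show "summable (\<lambda>n. K\<^sup>2 * inverse ((real n + 1)\<^sup>2))"
      by (intro summable_mult summable_inverse_Suc_square)
    fix n :: nat
    have "(cmod (f n))\<^sup>2 \<le> (K * (real n + 1) ^ k)\<^sup>2" by (intro power_mono K) simp
    then have "(cmod (f n))\<^sup>2 \<le> K\<^sup>2 * (real n + 1) ^ (2 * k)"
      by (simp add: power_mult_distrib power_mult[symmetric] mult.commute)
    then have "(cmod (f n))\<^sup>2 * inverse ((real n + 1) ^ (2 * Suc k))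
        \<le> K\<^sup>2 * (real n + 1) ^ (2 * k) * inverse ((real n + 1) ^ (2 * Suc k))"
      by (intro mult_right_mono) auto
    also have "\<dots> = K\<^sup>2 * inverse ((real n + 1)\<^sup>2)"
      by (simp add: power_add power2_eq_square)
    finally show "norm ((cmod (f n))\<^sup>2 * inverse ((real n + 1) ^ (2 * Suc k)))
        \<le> K\<^sup>2 * inverse ((real n + 1)\<^sup>2)" by simp
  qed
  then show "f \<in> tempered_distributions"
    unfolding tempered_distributions_def weighted_l2_def
    by (intro UN_I[of "Suc k"] CollectI) simp
qed

text \<open>Growth of order \<open>k\<close> is played against decay of order \<open>k + 2\<close>;
  the two extra powers pay for summability.\<close>

lemma summable_l1_norm:
  assumes f: "f \<in> tempered_distributions" and b: "rapidly_decreasing b"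
  shows "summable (\<lambda>n. cmod (f n) * b n)"
proof -
  obtain k K where K: "\<And>n. cmod (f n) \<le> K * (real n + 1) ^ k"
    using f tempered_distributions_iff by blast
  \<comment> \<open>The growth constant comes without a sign; the bound at \<open>n = 0\<close>
    forces it to be nonnegative.\<close>
  have K0: "0 \<le> K" using order_trans[OF norm_ge_zero K[of 0]] by simp
  obtain L where L: "\<And>n. b n * (real n + 1) ^ (k + 2) \<le> L"
    using b unfolding rapidly_decreasing_def by blast
  have b0: "0 \<le> b n" for n using b unfolding rapidly_decreasing_def by blast
  show ?thesis
  proof (rule summable_comparison_test')
    show "summable (\<lambda>n. K * L * inverse ((real n + 1)\<^sup>2))"
      by (intro summable_mult summable_inverse_Suc_square)
    fix n :: nat
    have "cmod (f n) * b n \<le> K * (real n + 1) ^ k * b n"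
      by (intro mult_right_mono K b0)
    also have "\<dots> = K * (b n * (real n + 1) ^ (k + 2)) * inverse ((real n + 1)\<^sup>2)"
      unfolding power_add by simp
    also have "\<dots> \<le> K * L * inverse ((real n + 1)\<^sup>2)"
      by (intro mult_right_mono mult_left_mono L K0) simp
    finally show "norm (cmod (f n) * b n) \<le> K * L * inverse ((real n + 1)\<^sup>2)"
      using b0 by simp
  qed
qed

lemma vector_space_seq_scale: "vector_space seq_scale"
  by unfold_locales (auto simp: seq_scale_def algebra_simps fun_eq_iff)

lemma tempered_zero: "0 \<in> tempered_distributions"
  unfolding tempered_distributions_iff by (intro exI[of _ 0]) simp

lemma tempered_add:
  assumes "f \<in> tempered_distributions" "g \<in> tempered_distributions"
  shows "f + g \<in> tempered_distributions"
proof -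
  obtain k K where K: "\<And>n. cmod (f n) \<le> K * (real n + 1) ^ k"
    using assms(1) tempered_distributions_iff by blast
  obtain l L where L: "\<And>n. cmod (g n) \<le> L * (real n + 1) ^ l"
    using assms(2) tempered_distributions_iff by blast
  have K0: "0 \<le> K" using order_trans[OF norm_ge_zero K[of 0]] by simp
  have L0: "0 \<le> L" using order_trans[OF norm_ge_zero L[of 0]] by simp
  have "cmod ((f + g) n) \<le> (K + L) * (real n + 1) ^ (k + l)" for n
  proof -
    have "cmod ((f + g) n) \<le> K * (real n + 1) ^ k + L * (real n + 1) ^ l"
      using norm_triangle_ineq[of "f n" "g n"] K[of n] L[of n] by simp
    also have "\<dots> \<le> K * (real n + 1) ^ (k + l) + L * (real n + 1) ^ (k + l)"
      by (intro add_mono mult_left_mono power_increasing K0 L0) auto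
    finally show ?thesis by (simp add: algebra_simps)
  qed
  then show ?thesis unfolding tempered_distributions_iff by blast
qed

lemma tempered_scale:
  assumes "f \<in> tempered_distributions"
  shows "seq_scale c f \<in> tempered_distributions"
proof -
  obtain k K where K: "\<And>n. cmod (f n) \<le> K * (real n + 1) ^ k"
    using assms(1) tempered_distributions_iff by blast
  have "cmod (seq_scale c f n) \<le> cmod c * K * (real n + 1) ^ k" for n
    using mult_left_mono[OF K[of n] norm_ge_zero[of c]]
    by (simp add: seq_scale_def norm_mult mult.assoc)
  then show ?thesis unfolding tempered_distributions_iff by blast
qed

lemma tempered_diff:
  assumes "f \<in> tempered_distributions" "g \<in> tempered_distributions"
  shows "f - g \<in> tempered_distributions"
proof -
  have "f - g = f + seq_scale (-1) g" by (auto simp: seq_scale_def fun_eq_iff)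
  then show ?thesis using assms tempered_add tempered_scale by metis
qed

lemma l1_norm_nonneg:
  assumes "f \<in> tempered_distributions" "rapidly_decreasing b"
  shows "0 \<le> l1_norm b f"
  unfolding l1_norm_def using assms
  by (intro suminf_nonneg summable_l1_norm) (auto simp: rapidly_decreasing_def)

lemma l1_norm_mono:
  assumes "g \<in> tempered_distributions" "rapidly_decreasing b" "f \<in> tempered_distributions"
    "rapidly_decreasing b'"
    and "\<And>n. cmod (f n) * b n \<le> cmod (g n) * b' n"
  shows "l1_norm b f \<le> l1_norm b' g"
  unfolding l1_norm_def using assms by (intro suminf_le summable_l1_norm) auto

lemma l1_norm_triangle:
  assumes f: "f \<in> tempered_distributions" and g: "g \<in> tempered_distributions"
    and b: "rapidly_decreasing b"
  shows "l1_norm b (f + g) \<le> l1_norm b f + l1_norm b g"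
proof -
  have b0: "0 \<le> b n" for n using b unfolding rapidly_decreasing_def by blast
  have "l1_norm b (f + g) \<le> (\<Sum>n. cmod (f n) * b n + cmod (g n) * b n)"
    unfolding l1_norm_def
    using summable_l1_norm[OF f b] summable_l1_norm[OF g b]
      summable_l1_norm[OF tempered_add[OF f g] b]
    by (intro suminf_le summable_add)
      (auto simp flip: distrib_right intro!: mult_right_mono norm_triangle_ineq b0)
  then show ?thesis
    unfolding l1_norm_def
    using suminf_add[OF summable_l1_norm[OF f b] summable_l1_norm[OF g b]] by simp
qed

lemma l1_norm_scale:
  assumes "f \<in> tempered_distributions" "rapidly_decreasing b"
  shows "l1_norm b (seq_scale c f) = cmod c * l1_norm b f"
  unfolding l1_norm_def using suminf_mult[OF summable_l1_norm[OF assms], of "cmod c"]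
  by (simp add: seq_scale_def norm_mult mult.assoc)

lemma l1_norm_scale_weight:
  assumes "f \<in> tempered_distributions" "rapidly_decreasing b"
  shows "l1_norm (\<lambda>n. c * b n) f = c * l1_norm b f"
  unfolding l1_norm_def using suminf_mult[OF summable_l1_norm[OF assms], of c]
  by (simp add: mult_ac)

lemma l1_norm_diff_commute: "l1_norm b (f - g) = l1_norm b (g - f)"
  unfolding l1_norm_def by (simp add: norm_minus_commute)

lemma l1_norm_diff_triangle:
  assumes "f \<in> tempered_distributions" "g \<in> tempered_distributions" "h \<in> tempered_distributions"
    and "rapidly_decreasing b"
  shows "l1_norm b (f - h) \<le> l1_norm b (f - g) + l1_norm b (g - h)"
  using l1_norm_triangle[of "f - g" "g - h" b] assms tempered_diff by simp

section \<open>The strong topology\<close>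

text \<open>The pointwise supremum over \<open>B\<close> serves as \<open>b\<close>. Each weighted
  \<open>l2\<close> norm bounds every single weighted coordinate, so norm bounds uniform over
  \<open>B\<close> become decay of every order for the supremum.\<close>

lemma bounded_subset_dominated:
  assumes B: "bounded_subset schwartz_norm schwartz_space B"
  obtains b where "rapidly_decreasing b" "\<And>\<phi> n. \<phi> \<in> B \<Longrightarrow> cmod (\<phi> n) \<le> b n"
proof
  \<comment> \<open>Inserting \<open>0\<close> keeps the supremum over a nonempty set when
    \<open>B\<close> is empty, and makes it nonnegative.\<close>
  define b where "b n = (SUP \<phi>\<in>insert 0 B. cmod (\<phi> n))" for n
  have bound: "\<exists>K\<ge>0. \<forall>\<phi>\<in>insert 0 B. \<forall>n. cmod (\<phi> n) * (real n + 1) ^ k \<le> K" for k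
  proof -
    \<comment> \<open>Only norms of index at least 1 are controlled, while \<open>k = 0\<close> is
      needed too; hence the shift to \<open>Suc k\<close>, which only strengthens the bound.\<close>
    have "bdd_above (schwartz_norm (Suc k) ` B)"
      using B unfolding bounded_subset_def by simp
    then obtain M where M: "\<And>\<phi>. \<phi> \<in> B \<Longrightarrow> schwartz_norm (Suc k) \<phi> \<le> M"
      unfolding bdd_above_def by auto
    \<comment> \<open>\<open>M\<close> says nothing about the inserted zero sequence and may be
      negative if \<open>B\<close> is empty; \<open>max M 0\<close> covers both.\<close>
    have "cmod (\<phi> n) * (real n + 1) ^ k \<le> max M 0" if "\<phi> \<in> insert 0 B" for \<phi> n
    proof (cases "\<phi> \<in> B")
      case True
      have s: "summable (\<lambda>n. (cmod (\<phi> n))\<^sup>2 * (real n + 1) ^ (2 * Suc k))"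
      proof -
        have "schwartz_space \<subseteq> weighted_l2 (\<lambda>n. (real n + 1) ^ (2 * Suc k))"
          unfolding schwartz_space_def by (rule INF_lower) simp
        then have "\<phi> \<in> weighted_l2 (\<lambda>n. (real n + 1) ^ (2 * Suc k))"
          using B True unfolding bounded_subset_def by blast
        then show ?thesis unfolding weighted_l2_def by blast
      qed
      have "(cmod (\<phi> n) * (real n + 1) ^ Suc k)\<^sup>2 = (cmod (\<phi> n))\<^sup>2 * (real n + 1) ^ (2 * Suc k)"
        by (simp only: power_mult_distrib power_mult[symmetric] mult.commute)
      also have "\<dots> \<le> (\<Sum>n. (cmod (\<phi> n))\<^sup>2 * (real n + 1) ^ (2 * Suc k))"
        by (rule term_le_suminf[OF s]) simp
      finally have "cmod (\<phi> n) * (real n + 1) ^ Suc k \<le> schwartz_norm (Suc k) \<phi>"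
        unfolding schwartz_norm_def weighted_norm_def by (rule real_le_rsqrt)
      moreover have "cmod (\<phi> n) * (real n + 1) ^ k \<le> cmod (\<phi> n) * (real n + 1) ^ Suc k"
        by (intro mult_left_mono power_increasing) auto
      ultimately show ?thesis using M[OF True] by simp
    qed (use that in auto)
    then show ?thesis by (intro exI[of _ "max M 0"]) auto
  qed
  have "bdd_above ((\<lambda>\<phi>. cmod (\<phi> n)) ` insert 0 B)" for n
  proof -
    obtain K where "\<And>\<phi>. \<phi> \<in> insert 0 B \<Longrightarrow> cmod (\<phi> n) * (real n + 1) ^ 0 \<le> K"
      using bound[of 0] by blast
    then show ?thesis by (intro bdd_aboveI[of _ K]) force
  qed
  then have upper: "cmod (\<phi> n) \<le> b n" if "\<phi> \<in> insert 0 B" for \<phi> n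
    unfolding b_def by (intro cSUP_upper that)
  then show "\<And>\<phi> n. \<phi> \<in> B \<Longrightarrow> cmod (\<phi> n) \<le> b n" by blast
  show "rapidly_decreasing b"
    unfolding rapidly_decreasing_def
  proof (intro conjI allI)
    show "0 \<le> b n" for n using upper[of 0 n] by simp
    fix k
    obtain K where K: "\<And>\<phi> n. \<phi> \<in> insert 0 B \<Longrightarrow> cmod (\<phi> n) * (real n + 1) ^ k \<le> K"
      using bound[of k] by blast
    have "b n \<le> K / (real n + 1) ^ k" for n
      unfolding b_def using K by (intro cSUP_least) (auto simp: field_simps)
    then show "\<exists>K. \<forall>n. b n * (real n + 1) ^ k \<le> K"
      by (intro exI[of _ K]) (auto simp: field_simps)
  qed
qed

text \<open>Decay of \<open>b\<close> of order \<open>p + 1\<close> leaves the factor 1/(n + 1)^2 in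
  the squared norm of index \<open>p\<close>. The resulting bound depends on \<open>b\<close> and
  \<open>p\<close> alone, hence is uniform over the box.\<close>

lemma bounded_subset_box:
  assumes b: "rapidly_decreasing b"
  shows "bounded_subset schwartz_norm schwartz_space {\<phi>. \<forall>n. cmod (\<phi> n) \<le> b n}"
proof -
  have main: "\<exists>M. \<forall>\<phi>. (\<forall>n. cmod (\<phi> n) \<le> b n) \<longrightarrow>
      summable (\<lambda>n. (cmod (\<phi> n))\<^sup>2 * (real n + 1) ^ (2 * p)) \<and> schwartz_norm p \<phi> \<le> M" for p
  proof -
    obtain K where K: "\<And>n. b n * (real n + 1) ^ Suc p \<le> K"
      using b unfolding rapidly_decreasing_def by blast
    let ?M = "\<lambda>n. K\<^sup>2 * inverse ((real n + 1)\<^sup>2)"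
    have sM: "summable ?M" by (intro summable_mult summable_inverse_Suc_square)
    have "summable (\<lambda>n. (cmod (\<phi> n))\<^sup>2 * (real n + 1) ^ (2 * p)) \<and>
        schwartz_norm p \<phi> \<le> sqrt (suminf ?M)" if \<phi>: "\<forall>n. cmod (\<phi> n) \<le> b n" for \<phi>
    proof
      have le: "(cmod (\<phi> n))\<^sup>2 * (real n + 1) ^ (2 * p) \<le> ?M n" for n
      proof -
        have "cmod (\<phi> n) * (real n + 1) ^ Suc p \<le> K"
          by (rule order_trans[OF mult_right_mono[OF \<phi>[rule_format]] K]) simp
        then have "(cmod (\<phi> n) * (real n + 1) ^ Suc p)\<^sup>2 \<le> K\<^sup>2"
          by (intro power_mono) auto
        then have "(cmod (\<phi> n) * (real n + 1) ^ Suc p)\<^sup>2 * inverse ((real n + 1)\<^sup>2) \<le> ?M n"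
          by (intro mult_right_mono) auto
        moreover have "(cmod (\<phi> n) * (real n + 1) ^ Suc p)\<^sup>2 * inverse ((real n + 1)\<^sup>2)
            = (cmod (\<phi> n))\<^sup>2 * (real n + 1) ^ (2 * p)"
        proof -
          have "(cmod (\<phi> n) * (real n + 1) ^ Suc p)\<^sup>2 * inverse ((real n + 1)\<^sup>2)
              = (cmod (\<phi> n))\<^sup>2 * (real n + 1) ^ (2 * p) * ((real n + 1)\<^sup>2 * inverse ((real n + 1)\<^sup>2))"
            by (simp only: power_Suc power_mult_distrib power_even_eq) (simp only: mult_ac)
          moreover have "(real n + 1)\<^sup>2 * inverse ((real n + 1)\<^sup>2) = 1"
            by (rule right_inverse) simp
          ultimately show ?thesis by simp
        qed
        ultimately show ?thesis by (simp only:)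
      qed
      show s: "summable (\<lambda>n. (cmod (\<phi> n))\<^sup>2 * (real n + 1) ^ (2 * p))"
        by (rule summable_comparison_test'[OF sM]) (use le in simp)
      show "schwartz_norm p \<phi> \<le> sqrt (suminf ?M)"
        unfolding schwartz_norm_def weighted_norm_def
        by (intro real_sqrt_le_mono suminf_le le s sM)
    qed
    then show ?thesis by blast
  qed
  show ?thesis
    unfolding bounded_subset_def
  proof (intro conjI allI impI subsetI)
    show "x \<in> schwartz_space" if "x \<in> {\<phi>. \<forall>n. cmod (\<phi> n) \<le> b n}" for x
      using main that unfolding schwartz_space_def weighted_l2_def by blast
    show "bdd_above (schwartz_norm p ` {\<phi>. \<forall>n. cmod (\<phi> n) \<le> b n})" for p
      using main[of p] unfolding bdd_above_def by blast
  qed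
qed

lemma pairing_le_l1_norm:
  assumes f: "f \<in> tempered_distributions" and b: "rapidly_decreasing b"
    and \<phi>: "\<And>n. cmod (\<phi> n) \<le> b n"
  shows "cmod (pairing f \<phi>) \<le> l1_norm b f"
proof -
  have "norm (f n * \<phi> n) \<le> cmod (f n) * b n" for n
    using \<phi>[of n] by (simp add: norm_mult mult_left_mono)
  then show ?thesis
    unfolding pairing_def l1_norm_def by (intro norm_suminf_le summable_l1_norm[OF f b])
qed

text \<open>Giving \<open>\<phi> n\<close> the conjugate phase of \<open>f n\<close> turns every
  term of the pairing into the nonnegative number \<open>cmod (f n) * b n\<close>.\<close>

lemma l1_norm_attained:
  assumes f: "f \<in> tempered_distributions" and b: "rapidly_decreasing b"
  obtains \<phi> where "\<And>n. cmod (\<phi> n) \<le> b n" "cmod (pairing f \<phi>) = l1_norm b f"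
proof
  have b0: "0 \<le> b n" for n using b unfolding rapidly_decreasing_def by blast
  \<comment> \<open>Where \<open>f n = 0\<close>, \<open>sgn\<close> is 0 and so is
    \<open>\<phi> n\<close>, which still lies in the box.\<close>
  define \<phi> where "\<phi> n = cnj (sgn (f n)) * of_real (b n)" for n
  show "cmod (\<phi> n) \<le> b n" for n
    using b0 by (simp add: \<phi>_def norm_mult norm_sgn)
  have "f n * \<phi> n = of_real (cmod (f n) * b n)" for n
    using complex_norm_square[of "f n", symmetric]
    by (cases "f n = 0") (simp_all add: \<phi>_def sgn_eq power2_eq_square flip: mult.assoc)
  then have "pairing f \<phi> = of_real (l1_norm b f)"
    unfolding pairing_def l1_norm_def by (simp only: suminf_of_real[OF summable_l1_norm[OF f b]])
  then show "cmod (pairing f \<phi>) = l1_norm b f"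
    using l1_norm_nonneg[OF f b] by simp
qed

text \<open>Every bounded set lies in a box, every box is bounded, and the supremum of the pairings
  over a box is an \<open>l1\<close> norm. Radius 1 suffices because the weights are closed under
  positive scaling.\<close>

lemma openin_tempered_topology:
  "openin tempered_topology U \<longleftrightarrow> U \<subseteq> tempered_distributions \<and>
     (\<forall>f\<in>U. \<exists>b. rapidly_decreasing b \<and> {g \<in> tempered_distributions. l1_norm b (g - f) < 1} \<subseteq> U)"
  (is "_ \<longleftrightarrow> ?R")
proof -
  have "strong_open schwartz_norm schwartz_space tempered_distributions U \<longleftrightarrow> ?R"
  proof
    assume U: "strong_open schwartz_norm schwartz_space tempered_distributions U"
    show ?R
    proof (intro conjI ballI)
      show sub: "U \<subseteq> tempered_distributions" using U by (simp add: strong_open_def)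
      fix f assume f: "f \<in> U"
      obtain B \<epsilon> where B: "bounded_subset schwartz_norm schwartz_space B" and e: "0 < \<epsilon>"
        and BU: "{g \<in> tempered_distributions. \<forall>\<phi>\<in>B. cmod (pairing (g - f) \<phi>) < \<epsilon>} \<subseteq> U"
        using U f unfolding strong_open_def by blast
      obtain b where b: "rapidly_decreasing b" and Bb: "\<And>\<phi> n. \<phi> \<in> B \<Longrightarrow> cmod (\<phi> n) \<le> b n"
        using bounded_subset_dominated[OF B] by blast
      show "\<exists>b. rapidly_decreasing b \<and> {g \<in> tempered_distributions. l1_norm b (g - f) < 1} \<subseteq> U"
      \<comment> \<open>Dividing the weight by \<open>\<epsilon>\<close> turns the ball of radius
        \<open>\<epsilon>\<close> into a unit ball.\<close>
      proof (intro exI[of _ "\<lambda>n. inverse \<epsilon> * b n"] conjI subsetI)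
        show "rapidly_decreasing (\<lambda>n. inverse \<epsilon> * b n)"
          using b e by (intro rapidly_decreasing_scale) auto
        fix g assume "g \<in> {g \<in> tempered_distributions. l1_norm (\<lambda>n. inverse \<epsilon> * b n) (g - f) < 1}"
        then have g: "g \<in> tempered_distributions" and *: "l1_norm (\<lambda>n. inverse \<epsilon> * b n) (g - f) < 1"
          by auto
        have gf: "g - f \<in> tempered_distributions" using g f sub by (blast intro: tempered_diff)
        have "l1_norm b (g - f) < \<epsilon>"
          using * e unfolding l1_norm_scale_weight[OF gf b] by (simp add: field_simps)
        then have "\<forall>\<phi>\<in>B. cmod (pairing (g - f) \<phi>) < \<epsilon>"
          using pairing_le_l1_norm[OF gf b] Bb by (meson le_less_trans)
        then show "g \<in> U" using BU g by blast
      qed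
    qed
  next
    assume R: ?R
    show "strong_open schwartz_norm schwartz_space tempered_distributions U"
      unfolding strong_open_def
    proof (intro conjI ballI)
      show sub: "U \<subseteq> tempered_distributions" using R by simp
      fix f assume f: "f \<in> U"
      obtain b where b: "rapidly_decreasing b"
        and bU: "{g \<in> tempered_distributions. l1_norm b (g - f) < 1} \<subseteq> U"
        using R f by blast
      have "{g \<in> tempered_distributions. \<forall>\<phi>\<in>{\<phi>. \<forall>n. cmod (\<phi> n) \<le> b n}. cmod (pairing (g - f) \<phi>) < 1}
          \<subseteq> U"
      proof
        fix g assume "g \<in> {g \<in> tempered_distributions.
            \<forall>\<phi>\<in>{\<phi>. \<forall>n. cmod (\<phi> n) \<le> b n}. cmod (pairing (g - f) \<phi>) < 1}"
        then have g: "g \<in> tempered_distributions"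
          and *: "\<And>\<phi>. \<forall>n. cmod (\<phi> n) \<le> b n \<Longrightarrow> cmod (pairing (g - f) \<phi>) < 1" by auto
        have "g - f \<in> tempered_distributions" using g f sub by (blast intro: tempered_diff)
        \<comment> \<open>The inequality stays strict because the supremum over the box is
          attained.\<close>
        then have "l1_norm b (g - f) < 1"
          using * l1_norm_attained[OF _ b] by metis
        then show "g \<in> U" using g bU by blast
      qed
      then show "\<exists>B \<epsilon>. bounded_subset schwartz_norm schwartz_space B \<and> 0 < \<epsilon> \<and>
          {g \<in> tempered_distributions. \<forall>\<phi>\<in>B. cmod (pairing (g - f) \<phi>) < \<epsilon>} \<subseteq> U"
        using bounded_subset_box[OF b] zero_less_one by blast
    qed
  qed
  then show ?thesis
    unfolding tempered_topology_def openin_strong_dual_topology .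
qed

lemma topspace_tempered_topology: "topspace tempered_topology = tempered_distributions"
proof
  show "topspace tempered_topology \<subseteq> tempered_distributions"
    using openin_topspace[of tempered_topology] unfolding openin_tempered_topology by blast
  have "openin tempered_topology tempered_distributions"
    unfolding openin_tempered_topology
    using rapidly_decreasing_indicator[of 0 0] by blast
  then show "tempered_distributions \<subseteq> topspace tempered_topology"
    by (rule openin_subset)
qed

lemma openin_l1_ball:
  assumes b: "rapidly_decreasing b" and f: "f \<in> tempered_distributions"
  shows "openin tempered_topology {g \<in> tempered_distributions. l1_norm b (g - f) < r}"
  unfolding openin_tempered_topology
proof (intro conjI ballI)
  fix g assume "g \<in> {g \<in> tempered_distributions. l1_norm b (g - f) < r}"
  then have g: "g \<in> tempered_distributions" and gr: "l1_norm b (g - f) < r" by auto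
  \<comment> \<open>The room left by the triangle inequality around \<open>g\<close>; it is again
    absorbed into the weight.\<close>
  define s where "s = r - l1_norm b (g - f)"
  have s: "0 < s" using gr by (simp add: s_def)
  have "{h \<in> tempered_distributions. l1_norm (\<lambda>n. inverse s * b n) (h - g) < 1}
      \<subseteq> {g \<in> tempered_distributions. l1_norm b (g - f) < r}"
  proof
    fix h assume "h \<in> {h \<in> tempered_distributions. l1_norm (\<lambda>n. inverse s * b n) (h - g) < 1}"
    then have h: "h \<in> tempered_distributions"
      and *: "l1_norm (\<lambda>n. inverse s * b n) (h - g) < 1" by auto
    have "l1_norm b (h - g) < s"
      using * s unfolding l1_norm_scale_weight[OF tempered_diff[OF h g] b]
      by (simp add: field_simps)
    then show "h \<in> {g \<in> tempered_distributions. l1_norm b (g - f) < r}"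
      using l1_norm_diff_triangle[OF h g f b] h by (simp add: s_def)
  qed
  moreover have "rapidly_decreasing (\<lambda>n. inverse s * b n)"
    using b s by (intro rapidly_decreasing_scale) auto
  ultimately show "\<exists>b'. rapidly_decreasing b' \<and>
      {h \<in> tempered_distributions. l1_norm b' (h - g) < 1}
      \<subseteq> {g \<in> tempered_distributions. l1_norm b (g - f) < r}" by blast
qed auto

lemma l1_norm_zero: "l1_norm b 0 = 0"
  by (simp add: l1_norm_def)

lemma l1_ball_centre:
  assumes "f \<in> tempered_distributions" "0 < r"
  shows "f \<in> {g \<in> tempered_distributions. l1_norm b (g - f) < r}"
  using assms by (simp add: l1_norm_zero)

section \<open>Continuity of the vector space operations, separation and local convexity\<close>

lemma continuous_map_add_tempered:
  "continuous_map (prod_topology tempered_topology tempered_topology) tempered_topology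
     (\<lambda>(x, y). x + y)"
  unfolding continuous_map_def
proof (intro conjI allI impI)
  show "(\<lambda>(x, y). x + y) \<in> topspace (prod_topology tempered_topology tempered_topology)
      \<rightarrow> topspace tempered_topology"
    by (auto simp: topspace_tempered_topology tempered_add)
  fix U assume U: "openin tempered_topology U"
  show "openin (prod_topology tempered_topology tempered_topology)
      {z \<in> topspace (prod_topology tempered_topology tempered_topology). (case z of (x, y) \<Rightarrow> x + y) \<in> U}"
    unfolding openin_prod_topology_alt
  proof (intro allI impI)
    fix x y
    assume "(x, y) \<in> {z \<in> topspace (prod_topology tempered_topology tempered_topology).
      (case z of (x, y) \<Rightarrow> x + y) \<in> U}"
    then have x: "x \<in> tempered_distributions" and y: "y \<in> tempered_distributions" and xy: "x + y \<in> U"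
      by (auto simp: topspace_tempered_topology)
    obtain b where b: "rapidly_decreasing b"
      and bU: "{g \<in> tempered_distributions. l1_norm b (g - (x + y)) < 1} \<subseteq> U"
      using U xy unfolding openin_tempered_topology by blast
    let ?B = "\<lambda>x. {g \<in> tempered_distributions. l1_norm b (g - x) < 1/2}"
    have "?B x \<times> ?B y \<subseteq> {z \<in> topspace (prod_topology tempered_topology tempered_topology).
        (case z of (x, y) \<Rightarrow> x + y) \<in> U}"
    proof clarify
      fix u v assume u: "u \<in> tempered_distributions" and v: "v \<in> tempered_distributions"
        and "l1_norm b (u - x) < 1/2" "l1_norm b (v - y) < 1/2"
      moreover have "l1_norm b (u + v - (x + y)) \<le> l1_norm b (u - x) + l1_norm b (v - y)"
        using l1_norm_triangle[OF tempered_diff[OF u x] tempered_diff[OF v y] b]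
        by (simp add: algebra_simps)
      ultimately have "u + v \<in> U" using bU tempered_add[OF u v] by auto
      then show "(u, v) \<in> topspace (prod_topology tempered_topology tempered_topology) \<and>
          u + v \<in> U" using u v by (simp add: topspace_tempered_topology)
    qed
    then show "\<exists>V W. openin tempered_topology V \<and> openin tempered_topology W \<and> x \<in> V \<and> y \<in> W \<and>
        V \<times> W \<subseteq> {z \<in> topspace (prod_topology tempered_topology tempered_topology).
        (case z of (x, y) \<Rightarrow> x + y) \<in> U}"
      using openin_l1_ball[OF b x, of "1/2"] openin_l1_ball[OF b y, of "1/2"]
        l1_ball_centre[OF x, of "1/2" b] l1_ball_centre[OF y, of "1/2" b]
      by (intro exI[of _ "?B x"] exI[of _ "?B y"]) auto
  qed
qed

text \<open>The difference \<open>c' u - c x\<close> splits as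
  \<open>c' (u - x) + (c' - c) x\<close>, and each summand is allowed half of the unit
  radius.\<close>

lemma continuous_map_scale_tempered:
  "continuous_map (prod_topology euclidean tempered_topology) tempered_topology
     (\<lambda>(c, x). seq_scale c x)"
  unfolding continuous_map_def
proof (intro conjI allI impI)
  show "(\<lambda>(c, x). seq_scale c x) \<in> topspace (prod_topology euclidean tempered_topology)
      \<rightarrow> topspace tempered_topology"
    by (auto simp: topspace_tempered_topology tempered_scale)
  fix U assume U: "openin tempered_topology U"
  let ?P = "{z \<in> topspace (prod_topology euclidean tempered_topology).
      (case z of (c, x) \<Rightarrow> seq_scale c x) \<in> U}"
  show "openin (prod_topology euclidean tempered_topology) ?P"
    unfolding openin_prod_topology_alt
  proof (intro allI impI)
    fix c x
    assume "(c, x) \<in> ?P"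
    then have x: "x \<in> tempered_distributions" and cx: "seq_scale c x \<in> U"
      by (auto simp: topspace_tempered_topology)
    obtain b where b: "rapidly_decreasing b"
      and bU: "{g \<in> tempered_distributions. l1_norm b (g - seq_scale c x) < 1} \<subseteq> U"
      using U cx unfolding openin_tempered_topology by blast
    define N where "N = l1_norm b x"
    have N: "0 \<le> N" unfolding N_def by (rule l1_norm_nonneg[OF x b])
    \<comment> \<open>The bound by 1 gives \<open>cmod c' \<le> cmod c + 1\<close>; the other entry
      makes \<open>d * N\<close> less than 1/2, with \<open>N + 1\<close> in place of
      \<open>N\<close> to avoid a zero denominator.\<close>
    define d where "d = min 1 (inverse (2 * (N + 1)))"
    have d: "0 < d" using N by (simp add: d_def)
    have dN: "d * N < 1/2"
    proof -
      have "d * N \<le> inverse (2 * (N + 1)) * N" using N by (intro mult_right_mono) (auto simp: d_def)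
      also have "\<dots> < 1/2" using N by (simp add: field_simps)
      finally show ?thesis .
    qed
    define r where "r = inverse (2 * (cmod c + 1))"
    have cc: "0 < cmod c + 1" by (smt (verit) norm_ge_zero)
    have r: "0 < r" using cc by (simp add: r_def)
    let ?B = "{g \<in> tempered_distributions. l1_norm b (g - x) < r}"
    have "ball c d \<times> ?B \<subseteq> ?P"
    proof clarify
      fix c' u assume c': "c' \<in> ball c d" and u: "u \<in> tempered_distributions"
        and ur: "l1_norm b (u - x) < r"
      have ux: "u - x \<in> tempered_distributions" by (rule tempered_diff[OF u x])
      have cd: "cmod (c' - c) < d" using c' by (simp add: dist_norm norm_minus_commute)
      have "cmod c' \<le> cmod c + 1"
        using cd norm_triangle_sub[of c' c] by (simp add: d_def)
      then have "cmod c' * l1_norm b (u - x) \<le> (cmod c + 1) * r"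
        using ur l1_norm_nonneg[OF ux b] by (intro mult_mono) auto
      also have "\<dots> = 1/2" using cc by (simp add: r_def field_simps)
      finally have 1: "cmod c' * l1_norm b (u - x) \<le> 1/2" .
      have "cmod (c' - c) * N \<le> d * N" using cd N by (intro mult_right_mono) auto
      \<comment> \<open>This half is strict while the first need not be, so the sum stays below
        1.\<close>
      then have 2: "cmod (c' - c) * N < 1/2" using dN by simp
      have "seq_scale c' u - seq_scale c x = seq_scale c' (u - x) + seq_scale (c' - c) x"
        by (auto simp: seq_scale_def algebra_simps fun_eq_iff)
      then have "l1_norm b (seq_scale c' u - seq_scale c x) \<le>
          cmod c' * l1_norm b (u - x) + cmod (c' - c) * N"
        using l1_norm_triangle[OF tempered_scale[OF ux] tempered_scale[OF x] b, of c' "c' - c"]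
        by (simp only: l1_norm_scale[OF ux b] l1_norm_scale[OF x b] N_def)
      then have "seq_scale c' u \<in> U" using 1 2 bU tempered_scale[OF u] by auto
      then show "(c', u) \<in> topspace (prod_topology euclidean tempered_topology) \<and>
          seq_scale c' u \<in> U" using u by (simp add: topspace_tempered_topology)
    qed
    then show "\<exists>V W. openin euclidean V \<and> openin tempered_topology W \<and> c \<in> V \<and> x \<in> W \<and>
        V \<times> W \<subseteq> ?P"
      using openin_l1_ball[OF b x, of r] l1_ball_centre[OF x r, of b] d
      by (intro exI[of _ "ball c d"] exI[of _ ?B]) auto
  qed
qed

text \<open>Two distinct sequences differ at some coordinate \<open>m\<close>. The weight
  concentrated at \<open>m\<close> measures only that coordinate, and balls of half the distance
  there are disjoint.\<close>

lemma Hausdorff_tempered_topology: "Hausdorff_space tempered_topology"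
  unfolding Hausdorff_space_def
proof (intro allI impI)
  fix f g assume "f \<in> topspace tempered_topology \<and> g \<in> topspace tempered_topology \<and> f \<noteq> g"
  then have f: "f \<in> tempered_distributions" and g: "g \<in> tempered_distributions" and ne: "f \<noteq> g"
    by (auto simp: topspace_tempered_topology)
  obtain m where m: "f m \<noteq> g m" using ne by (auto simp: fun_eq_iff)
  define b where "b i = (if i = m then 1 else 0::real)" for i
  have b: "rapidly_decreasing b" unfolding b_def by (rule rapidly_decreasing_indicator) simp
  have coord: "l1_norm b h = cmod (h m)" for h
  proof -
    have "l1_norm b h = (\<Sum>n\<in>{m}. cmod (h n) * b n)"
      unfolding l1_norm_def by (rule suminf_finite) (auto simp: b_def)
    then show ?thesis by (simp add: b_def)
  qed
  define r where "r = cmod (f m - g m) / 2"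
  have r: "0 < r" using m by (simp add: r_def)
  let ?B = "\<lambda>f. {h \<in> tempered_distributions. l1_norm b (h - f) < r}"
  have "disjnt (?B f) (?B g)"
  proof -
    have False if "cmod (h m - f m) < r" "cmod (h m - g m) < r" for h :: seq
      using that norm_triangle_ineq4[of "h m - g m" "h m - f m"] unfolding r_def by simp
    then show ?thesis unfolding disjnt_def coord by auto
  qed
  then show "\<exists>U V. openin tempered_topology U \<and> openin tempered_topology V \<and> f \<in> U \<and> g \<in> V \<and>
      disjnt U V"
    using openin_l1_ball[OF b f, of r] openin_l1_ball[OF b g, of r]
      l1_ball_centre[OF f r, of b] l1_ball_centre[OF g r, of b] by blast
qed

lemma locally_convex_tempered:
  "locally_convex_space seq_scale tempered_distributions tempered_topology"
  unfolding locally_convex_space_def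
proof (intro conjI allI impI)
  interpret vector_space seq_scale by (rule vector_space_seq_scale)
  show "module.subspace seq_scale tempered_distributions"
    unfolding subspace_def using tempered_zero tempered_add tempered_scale by blast
  fix U assume "openin tempered_topology U \<and> 0 \<in> U"
  then obtain b where b: "rapidly_decreasing b"
    and bU: "{g \<in> tempered_distributions. l1_norm b (g - 0) < 1} \<subseteq> U"
    unfolding openin_tempered_topology by blast
  \<comment> \<open>Balls of a seminorm are convex, so the unit ball itself is the required
    neighbourhood.\<close>
  let ?V = "{g \<in> tempered_distributions. l1_norm b (g - 0) < 1}"
  have "seq_scale (of_real (1 - t)) x + seq_scale (of_real t) y \<in> ?V"
    if xV: "x \<in> ?V" and yV: "y \<in> ?V" and t: "t \<in> {0..1}" for x y and t :: real
  proof -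
    have x: "x \<in> tempered_distributions" "l1_norm b x < 1"
      and y: "y \<in> tempered_distributions" "l1_norm b y < 1" using xV yV by auto
    have "l1_norm b (seq_scale (of_real (1 - t)) x + seq_scale (of_real t) y)
        \<le> (1 - t) * l1_norm b x + t * l1_norm b y"
      using l1_norm_triangle[OF tempered_scale[OF x(1)] tempered_scale[OF y(1)] b,
          of "of_real (1 - t)" "of_real t"] t
      by (simp add: l1_norm_scale[OF x(1) b] l1_norm_scale[OF y(1) b] del: of_real_diff)
    also have "\<dots> < 1"
      using x(2) y(2) t by (intro convex_bound_lt) auto
    finally show ?thesis using tempered_add tempered_scale x(1) y(1) by auto
  qed
  then show "\<exists>V. openin tempered_topology V \<and> 0 \<in> V \<and> V \<subseteq> U \<and>
      (\<forall>x\<in>V. \<forall>y\<in>V. \<forall>t\<in>{0..1::real}.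
        seq_scale (of_real (1 - t)) x + seq_scale (of_real t) y \<in> V)"
    using openin_l1_ball[OF b tempered_zero, of 1] l1_ball_centre[OF tempered_zero, of 1 b] bU
    by (intro exI[of _ ?V]) auto
qed (simp_all add: vector_space_seq_scale topspace_tempered_topology Hausdorff_tempered_topology
      continuous_map_add_tempered continuous_map_scale_tempered)

section \<open>Nuclearity\<close>

text \<open>Continuity is the reverse triangle inequality: on the \<open>l1\<close> ball of radius
  \<open>e\<close> around \<open>f\<close> the norm changes by less than \<open>e\<close>.\<close>

lemma continuous_seminorm_l1_norm:
  assumes b: "rapidly_decreasing b"
  shows "continuous_seminorm seq_scale tempered_distributions tempered_topology (l1_norm b)"
  unfolding continuous_seminorm_def
proof (intro conjI ballI allI)
  show "continuous_map tempered_topology euclideanreal (l1_norm b)"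
    unfolding continuous_map_def
  proof (intro conjI allI impI)
    fix U assume "openin euclideanreal U"
    then have U: "open U" by simp
    show "openin tempered_topology {x \<in> topspace tempered_topology. l1_norm b x \<in> U}"
      unfolding openin_subopen[of _ "{x \<in> topspace tempered_topology. l1_norm b x \<in> U}"]
    proof
      fix f assume "f \<in> {x \<in> topspace tempered_topology. l1_norm b x \<in> U}"
      then have f: "f \<in> tempered_distributions" and fU: "l1_norm b f \<in> U"
        by (auto simp: topspace_tempered_topology)
      obtain e where e: "0 < e" and eU: "ball (l1_norm b f) e \<subseteq> U"
        using U fU by (auto simp: open_contains_ball)
      let ?B = "{g \<in> tempered_distributions. l1_norm b (g - f) < e}"
      have "?B \<subseteq> {x \<in> topspace tempered_topology. l1_norm b x \<in> U}"
      proof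
        fix g assume "g \<in> ?B"
        then have g: "g \<in> tempered_distributions" and ge: "l1_norm b (g - f) < e" by auto
        have "l1_norm b g \<le> l1_norm b (g - f) + l1_norm b f"
          using l1_norm_diff_triangle[OF g f tempered_zero b] by simp
        moreover have "l1_norm b f \<le> l1_norm b (g - f) + l1_norm b g"
          using l1_norm_diff_triangle[OF f g tempered_zero b] by (simp add: l1_norm_diff_commute)
        ultimately have "l1_norm b g \<in> ball (l1_norm b f) e" using ge by (simp add: dist_real_def)
        then show "g \<in> {x \<in> topspace tempered_topology. l1_norm b x \<in> U}"
          using eU g by (auto simp: topspace_tempered_topology)
      qed
      then show "\<exists>T. openin tempered_topology T \<and> f \<in> T \<and>
          T \<subseteq> {x \<in> topspace tempered_topology. l1_norm b x \<in> U}"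
        using openin_l1_ball[OF b f, of e] l1_ball_centre[OF f e, of b] by blast
    qed
  qed simp
qed (use b in \<open>auto intro: l1_norm_nonneg l1_norm_triangle l1_norm_scale\<close>)

text \<open>The open set where \<open>p\<close> is below 1 contains a unit ball of some
  \<open>l1\<close> norm, and homogeneity spreads this to a global estimate.\<close>

lemma continuous_seminorm_le_l1_norm:
  assumes p: "continuous_seminorm seq_scale tempered_distributions tempered_topology p"
  obtains b where "rapidly_decreasing b" "\<And>f. f \<in> tempered_distributions \<Longrightarrow> p f \<le> l1_norm b f"
proof -
  have scale: "p (seq_scale c x) = cmod c * p x" if "x \<in> tempered_distributions" for c x
    using p that unfolding continuous_seminorm_def by blast
  have p0: "p 0 = 0" using scale[OF tempered_zero, of 0] by (simp add: seq_scale_def zero_fun_def)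
  have "openin tempered_topology {x \<in> topspace tempered_topology. p x \<in> {..<1}}"
    using p unfolding continuous_seminorm_def
    by (intro openin_continuous_map_preimage[of _ euclideanreal]) auto
  moreover have "0 \<in> {x \<in> topspace tempered_topology. p x \<in> {..<1}}"
    using p0 tempered_zero by (simp add: topspace_tempered_topology)
  ultimately obtain b where b: "rapidly_decreasing b" and
    sub: "{g \<in> tempered_distributions. l1_norm b (g - 0) < 1}
      \<subseteq> {x \<in> topspace tempered_topology. p x \<in> {..<1}}"
    unfolding openin_tempered_topology by blast
  have "p f \<le> l1_norm b f" if f: "f \<in> tempered_distributions" for f
  \<comment> \<open>Normalising by every \<open>s\<close> above \<open>l1_norm b f\<close>, rather
    than by the norm itself, includes the case where that norm vanishes.\<close>
  proof (rule dense_ge)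
    fix s assume s: "l1_norm b f < s"
    then have s0: "0 < s" using l1_norm_nonneg[OF f b] by simp
    let ?g = "seq_scale (of_real (inverse s)) f"
    have cs: "cmod (of_real (inverse s)) = inverse s"
      using s0 unfolding norm_of_real by simp
    have "l1_norm b ?g < 1"
      using s s0 unfolding l1_norm_scale[OF f b] cs by (simp add: field_simps)
    then have "?g \<in> {g \<in> tempered_distributions. l1_norm b (g - 0) < 1}"
      using tempered_scale[OF f] by simp
    then have "p ?g < 1" using sub by blast
    then show "p f \<le> s"
      using s0 unfolding scale[OF f] cs by (simp add: field_simps)
  qed
  then show ?thesis using that b by blast
qed

definition unit_seq :: "nat \<Rightarrow> seq" where
  "unit_seq i = (\<lambda>n. if n = i then 1 else 0)"

lemma l1_norm_unit_seq: "l1_norm b (unit_seq i) = b i"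
proof -
  have "l1_norm b (unit_seq i) = (\<Sum>n\<in>{i}. cmod (unit_seq i n) * b n)"
    unfolding l1_norm_def by (rule suminf_finite) (auto simp: unit_seq_def)
  then show ?thesis by (simp add: unit_seq_def)
qed

lemma unit_seq_tempered: "unit_seq i \<in> tempered_distributions"
  unfolding tempered_distributions_iff
  by (intro exI[of _ 0] exI[of _ 1]) (auto simp: unit_seq_def)

lemma sum_seq_scale_unit_seq:
  "(\<Sum>i<n. seq_scale (c i) (unit_seq i)) = (\<lambda>m. if m < n then c m else 0)"
  by (induction n) (auto simp: fun_eq_iff seq_scale_def unit_seq_def less_Suc_eq)

text \<open>The \<open>i\<close>-th coordinate functional has dual norm at most the inverse of
  \<open>(i + 1)^2 * b i\<close> when \<open>b i\<close> is nonzero, and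
  \<open>p (unit_seq i)\<close> is at most \<open>b i\<close>; the product is at most 1/(i +
  1)^2.\<close>

lemma nuclear_canonical_map_tempered:
  assumes p: "continuous_seminorm seq_scale tempered_distributions tempered_topology p"
    and b: "rapidly_decreasing b"
    and pb: "\<And>f. f \<in> tempered_distributions \<Longrightarrow> p f \<le> l1_norm b f"
  shows "nuclear_canonical_map seq_scale tempered_distributions
    (l1_norm (\<lambda>n. (real n + 1)\<^sup>2 * b n)) p"
proof -
  let ?b = "\<lambda>n. (real n + 1)\<^sup>2 * b n"
  have b': "rapidly_decreasing ?b" by (rule rapidly_decreasing_times_power[OF b])
  have b0: "0 \<le> b n" for n using b unfolding rapidly_decreasing_def by blast
  have pnn: "0 \<le> p f" if "f \<in> tempered_distributions" for f
    using p that unfolding continuous_seminorm_def by blast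
  \<comment> \<open>Where \<open>b i = 0\<close> the dual-norm bound \<open>inverse (?b i)\<close> is the junk value 0, so the functional must vanish.\<close>
  define l :: "nat \<Rightarrow> seq \<Rightarrow> complex" where "l i f = (if b i = 0 then 0 else f i)" for i f
  show ?thesis
    unfolding nuclear_canonical_map_def
  proof (intro exI[of _ l] exI[of _ unit_seq] exI[of _ "\<lambda>i. inverse (?b i)"] conjI allI ballI)
    show "linear_functional_on seq_scale tempered_distributions (l i)" for i
      by (auto simp: linear_functional_on_def l_def seq_scale_def)
    show "0 \<le> inverse (?b i)" for i using b0 by simp
    show "unit_seq i \<in> tempered_distributions" for i by (rule unit_seq_tempered)
    show "cmod (l i f) \<le> inverse (?b i) * l1_norm ?b f"
      if f: "f \<in> tempered_distributions" for f i
    proof (cases "b i = 0")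
      case False
      then have "0 < ?b i" using b0[of i] by simp
      moreover have "cmod (f i) * ?b i \<le> l1_norm ?b f"
        unfolding l1_norm_def
        by (rule term_le_suminf[OF summable_l1_norm[OF f b']]) (simp add: b0)
      ultimately show ?thesis using False by (simp add: l_def field_simps)
    qed (simp add: l_def)
    show "summable (\<lambda>i. inverse (?b i) * p (unit_seq i))"
    proof (rule summable_comparison_test'[OF summable_inverse_Suc_square])
      fix i
      have "p (unit_seq i) \<le> b i"
        using pb[OF unit_seq_tempered, of i] by (simp add: l1_norm_unit_seq)
      then have "inverse (?b i) * p (unit_seq i) \<le> inverse (?b i) * b i"
        using b0 by (intro mult_left_mono) auto
      \<comment> \<open>Equality for \<open>b i\<close> nonzero; otherwise the left side is
        0.\<close>
      also have "\<dots> \<le> inverse ((real i + 1)\<^sup>2)"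
        by (cases "b i = 0") (auto simp: field_simps)
      finally show "norm (inverse (?b i) * p (unit_seq i)) \<le> inverse ((real i + 1)\<^sup>2)"
        using pnn[OF unit_seq_tempered, of i] b0[of i] by simp
    qed
    fix f assume f: "f \<in> tempered_distributions"
    let ?r = "\<lambda>n. f - (\<Sum>i<n. seq_scale (l i f) (unit_seq i))"
    have s: "summable (\<lambda>n. cmod (f n) * b n)" by (rule summable_l1_norm[OF f b])
    have r: "?r n \<in> tempered_distributions" for n
    proof -
      have "(\<Sum>i<n. seq_scale (l i f) (unit_seq i)) \<in> tempered_distributions"
        by (induction n) (simp_all only: sum.lessThan_Suc lessThan_0 sum.empty
          tempered_zero tempered_add tempered_scale unit_seq_tempered)
      then show ?thesis by (rule tempered_diff[OF f])
    qed
    have "l1_norm b (?r n) = (\<Sum>k. cmod (f (k + n)) * b (k + n))" for n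
    proof -
      \<comment> \<open>If \<open>k < n\<close> and \<open>b k = 0\<close>, the vanishing functional
        leaves \<open>f k\<close> in the remainder, but the weight removes it; so the norm of the
        remainder is exactly the tail of the series.\<close>
      have *: "cmod (?r n k) * b k = (if k < n then 0 else cmod (f k) * b k)" for k
        by (simp add: sum_seq_scale_unit_seq l_def)
      have "l1_norm b (?r n) = (\<Sum>k. cmod (?r n (k + n)) * b (k + n))"
        unfolding l1_norm_def
        using suminf_split_initial_segment[OF summable_l1_norm[OF r[of n] b], of n] *
        by simp
      then show ?thesis unfolding * by simp
    qed
    moreover have "(\<lambda>n. \<Sum>k. cmod (f (k + n)) * b (k + n)) \<longlonglongrightarrow> 0"
      by (rule suminf_exist_split2[OF s])
    ultimately have "(\<lambda>n. l1_norm b (?r n)) \<longlonglongrightarrow> 0" by simp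
    then show "(\<lambda>n. p (?r n)) \<longlonglongrightarrow> 0"
      by (rule tendsto_sandwich[OF _ _ tendsto_const, rotated 2]) (auto simp: pnn pb r)
  qed
qed

lemma nuclear_space_tempered:
  "nuclear_space seq_scale tempered_distributions tempered_topology"
  unfolding nuclear_space_def
proof (intro conjI allI impI locally_convex_tempered)
  fix p assume p: "continuous_seminorm seq_scale tempered_distributions tempered_topology p"
  obtain b where b: "rapidly_decreasing b"
    and pb: "\<And>f. f \<in> tempered_distributions \<Longrightarrow> p f \<le> l1_norm b f"
    using continuous_seminorm_le_l1_norm[OF p] by blast
  let ?b = "\<lambda>n. (real n + 1)\<^sup>2 * b n"
  have b': "rapidly_decreasing ?b" by (rule rapidly_decreasing_times_power[OF b])
  have le: "b n \<le> ?b n" for n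
    using mult_right_mono[of 1 "(real n + 1)\<^sup>2" "b n"] b by (simp add: rapidly_decreasing_def)
  have "p f \<le> l1_norm ?b f" if f: "f \<in> tempered_distributions" for f
  proof -
    have "l1_norm b f \<le> l1_norm ?b f"
      using f b b' le by (intro l1_norm_mono mult_left_mono) auto
    then show ?thesis using pb[OF f] by simp
  qed
  then show "\<exists>q. continuous_seminorm seq_scale tempered_distributions tempered_topology q \<and>
      (\<forall>x\<in>tempered_distributions. p x \<le> q x) \<and>
      nuclear_canonical_map seq_scale tempered_distributions q p"
    using continuous_seminorm_l1_norm[OF b'] nuclear_canonical_map_tempered[OF p b pb] by blast
qed

section \<open>Failure of the Vage inequality\<close>

text \<open>A discrete mean value estimate: (p + 1)(x + 1)^p is the largest derivative of t^(p + 1)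
  on the interval from x to x + 1.\<close>

lemma power_Suc_diff_le:
  fixes x :: real
  assumes "0 \<le> x"
  shows "(x + 1) ^ Suc p - x ^ Suc p \<le> real (Suc p) * (x + 1) ^ p"
proof (induction p)
  case (Suc p)
  have "(x + 1) ^ Suc (Suc p) - x ^ Suc (Suc p)
      = (x + 1) * ((x + 1) ^ Suc p - x ^ Suc p) + x ^ Suc p"
    by (simp add: algebra_simps)
  also have "\<dots> \<le> (x + 1) * (real (Suc p) * (x + 1) ^ p) + (x + 1) ^ Suc p"
    using assms Suc by (intro add_mono mult_left_mono power_mono) auto
  finally show ?case by (simp add: algebra_simps)
qed simp

text \<open>Telescoping the preceding estimate compares the sum with the integral of t^p from 0 to n
  + 1.\<close>

lemma sum_powers_lower_bound:
  "(real n + 1) ^ Suc p \<le> real (Suc p) * (\<Sum>m\<le>n. (real m + 1) ^ p)"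
proof (induction n)
  case (Suc n)
  then show ?case
    using power_Suc_diff_le[of "real n + 1" p] by (simp add: algebra_simps)
qed simp

text \<open>The contradiction comes from membership of the convolution in the \<open>p\<close>-th
  space: its weighted squares stay above a positive constant, so their series cannot
  converge.\<close>

lemma not_vage_space:
  assumes a: "\<And>n. a n = (real n + 1)\<^sup>2"
  shows "\<not> vage_space a"
proof
  assume "vage_space a"
  then obtain e where conv: "\<And>q p f g. 1 \<le> q \<Longrightarrow> q + e \<le> p \<Longrightarrow> f \<in> dual_l2 a q \<Longrightarrow> g \<in> dual_l2 a p
      \<Longrightarrow> convolution f g \<in> dual_l2 a p"
    unfolding vage_space_def by blast
  define f :: seq where "f = (\<lambda>_. 1)"
  define g :: seq where "g = (\<lambda>n. of_real ((real n + 1) ^ e))"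
  \<comment> \<open>With \<open>k = e\<close> the second factor cancels the square of
    \<open>g n\<close> exactly, leaving the summable 1/(n + 1)^2.\<close>
  have aq: "inverse (a n ^ Suc k) = inverse ((real n + 1)\<^sup>2) * inverse (((real n + 1) ^ k)\<^sup>2)" for n k
    by (simp add: a power_mult[symmetric] mult.commute)
  have "f \<in> dual_l2 a 1"
    using summable_inverse_Suc_square by (simp add: dual_l2_def weighted_l2_def f_def a)
  moreover have "g \<in> dual_l2 a (Suc e)"
  proof -
    have "(cmod (g n))\<^sup>2 * inverse (a n ^ Suc e) = inverse ((real n + 1)\<^sup>2)" for n
      unfolding aq by (simp add: g_def norm_power del: of_real_power of_real_add)
    then show ?thesis
      using summable_inverse_Suc_square by (simp add: dual_l2_def weighted_l2_def)
  qed
  ultimately have "convolution f g \<in> dual_l2 a (Suc e)" by (intro conv[of 1]) auto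
  then have "(\<lambda>n. (cmod (convolution f g n))\<^sup>2 * inverse (a n ^ Suc e)) \<longlonglongrightarrow> 0"
    unfolding dual_l2_def weighted_l2_def by (simp add: summable_LIMSEQ_zero)
  \<comment> \<open>The convolution is at least (n + 1)^(e + 1) / (e + 1), and the weight is exactly
    (n + 1)^(-2(e + 1)); the powers of n + 1 cancel.\<close>
  moreover have "(inverse (real (Suc e)))\<^sup>2 \<le> (cmod (convolution f g n))\<^sup>2 * inverse (a n ^ Suc e)"
    for n
  proof -
    have "convolution f g n = (\<Sum>m\<le>n. g (n - m))" by (simp add: convolution_def f_def)
    also have "\<dots> = (\<Sum>m\<le>n. g m)"
      by (rule sum.nat_diff_reindex[of g "Suc n", unfolded lessThan_Suc_atMost, simplified])
    also have "\<dots> = of_real (\<Sum>m\<le>n. (real m + 1) ^ e)" by (simp add: g_def)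
    finally have "cmod (convolution f g n) = (\<Sum>m\<le>n. (real m + 1) ^ e)"
      by (simp add: sum_nonneg del: of_real_sum)
    then have "(real n + 1) ^ Suc e \<le> real (Suc e) * cmod (convolution f g n)"
      using sum_powers_lower_bound by simp
    then have "inverse (real (Suc e)) \<le> cmod (convolution f g n) * inverse ((real n + 1) ^ Suc e)"
      using zero_less_power[of "real n + 1" "Suc e"]
      by (simp add: field_simps del: power_Suc of_nat_Suc)
    then have "(inverse (real (Suc e)))\<^sup>2
        \<le> (cmod (convolution f g n) * inverse ((real n + 1) ^ Suc e))\<^sup>2"
      by (intro power_mono) auto
    also have "\<dots> = (cmod (convolution f g n))\<^sup>2 * inverse (a n ^ Suc e)"
      by (simp only: a power_mult_distrib power_inverse power_mult[symmetric] mult.commute)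
    finally show ?thesis .
  qed
  ultimately have "(inverse (real (Suc e)))\<^sup>2 \<le> 0"
    using LIMSEQ_le_const by blast
  then show False by simp
qed

theorem proposition6p1:
  fixes a :: "nat \<Rightarrow> real"
  assumes "\<And>n. a n = (real n + 1)\<^sup>2"
  shows "tempered_distributions = F_dual a \<and>
         tempered_topology = F_dual_topology a \<and>
         regular_admissible_space a \<and>
         nuclear_space seq_scale tempered_distributions tempered_topology \<and>
         \<not> vage_space a"
proof (intro conjI)
  \<comment> \<open>This identity matches all weights, so the norms, the spaces and hence the strong
    dual topologies coincide literally.\<close>
  have pow: "a n ^ p = (real n + 1) ^ (2 * p)" for n p
    by (simp add: assms power_mult)
  show dual: "tempered_distributions = F_dual a"
    by (simp add: tempered_distributions_def F_dual_def dual_l2_def pow)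
  have "schwartz_norm = F_norm a"
    by (simp add: fun_eq_iff schwartz_norm_def F_norm_def pow)
  moreover have "schwartz_space = F_space a"
    by (simp add: schwartz_space_def F_space_def pow)
  ultimately show "tempered_topology = F_dual_topology a"
    by (simp add: tempered_topology_def F_dual_topology_def dual)
  have "admissible a" by (simp add: admissible_def assms)
  \<comment> \<open>Regularity is summability over a single index, so it holds for every
    exponent.\<close>
  then show "regular_admissible_space a"
    unfolding regular_admissible_space_def regular_def by (auto intro: summable_on_finite)
qed (simp_all add: nuclear_space_tempered not_vage_space assms)

end
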